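(* An immersed holomorphic curve in $\mathbb{L}(\mathbb{H}^3)$ cannot be of rank 1.
   Context: $\mathbb{L}(\mathbb{H}^3)$ denotes the space of oriented geodesics of hyperbolic 3-space $\mathbb{H}^3$. It is a complex surface, biholomorphic to $\mathbb{P}^1\times\mathbb{P}^1-\overline{\Delta}$, where in holomorphic coordinates $(\mu_1,\mu_2)$ on $\mathbb{P}^1\times\mathbb{P}^1$ one has $\overline{\Delta}=\{(\mu_1,\mu_2):\mu_1\bar\mu_2=-1\}$. In the upper half-space model $\{(z,t): z\in\mathbb{C},\,t>0\}$, the oriented geodesic with coordinates $(\mu_1,\mu_2)$ begins at the boundary point $z=-\mu_1$ and ends at the boundary point $z=1/\bar\mu_2$. Denote by $\mathbb{J}$ the complex structure. A surface means a smooth real 2-dimensional surface. A point $\gamma$ of a surface $\Sigma\subset\mathbb{L}(\mathbb{H}^3)$ is a complex point if $\mathbb{J}$ preserves $T_\gamma\Sigma$; $\Sigma$ is a holomorphic curve if all of its points are complex points. The rank of an immersion $f:\Sigma\to\mathbb{L}(\mathbb{H}^3)$ at a point $\gamma$ is the (real) rank, 0, 1 or 2, of $(\pi\circ f)_*:T_\gamma\Sigma\to T\mathbb{P}^1$, where $\pi$ is the projection onto the first factor $\mu_1$. A surface is of rank $k$ if the rank is $k$ at every point. *)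

theory Defs
  imports "HOL-Analysis.Analysis"
begin

section \<open>Smooth functions and smooth manifolds\<close>

text \<open>To be used on open sets \<open>S\<close> only.\<close>

primrec Ck_on :: "nat \<Rightarrow> 'a::euclidean_space set \<Rightarrow> ('a \<Rightarrow> 'b::euclidean_space) \<Rightarrow> bool" where
  "Ck_on 0 S f \<longleftrightarrow> continuous_on S f"
| "Ck_on (Suc k) S f \<longleftrightarrow>
     (\<forall>x\<in>S. f differentiable (at x)) \<and> (\<forall>v. Ck_on k S (\<lambda>x. frechet_derivative f (at x) v))"

definition smooth_on :: "'a::euclidean_space set \<Rightarrow> ('a \<Rightarrow> 'b::euclidean_space) \<Rightarrow> bool" where
  "smooth_on S f \<longleftrightarrow> (\<forall>k. Ck_on k S f)"

type_synonym ('a, 'e) chart = "'a set \<times> ('a \<Rightarrow> 'e)"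

record ('a, 'e) manifold =
  mtop :: "'a topology"
  charts :: "('a, 'e) chart set"

definition smooth_manifold :: "('a, 'e::euclidean_space) manifold \<Rightarrow> bool" where
  "smooth_manifold M \<longleftrightarrow>
     Hausdorff_space (mtop M) \<and> second_countable (mtop M) \<and>
     (\<Union>(U, \<phi>)\<in>charts M. U) = topspace (mtop M) \<and>
     (\<forall>(U, \<phi>)\<in>charts M. openin (mtop M) U \<and> open (\<phi> ` U) \<and>
        homeomorphic_map (subtopology (mtop M) U) (top_of_set (\<phi> ` U)) \<phi>) \<and>
     (\<forall>(U, \<phi>)\<in>charts M. \<forall>(V, \<psi>)\<in>charts M.
        smooth_on (\<phi> ` (U \<inter> V)) (\<psi> \<circ> inv_into U \<phi>))"

definition smooth_map ::
  "('a, 'e::euclidean_space) manifold \<Rightarrow> ('b, 'f::euclidean_space) manifold \<Rightarrow> ('a \<Rightarrow> 'b) \<Rightarrow> bool" where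
  "smooth_map M N f \<longleftrightarrow>
     continuous_map (mtop M) (mtop N) f \<and>
     (\<forall>(U, \<phi>)\<in>charts M. \<forall>(V, \<psi>)\<in>charts N.
        smooth_on (\<phi> ` (U \<inter> f -` V)) (\<psi> \<circ> f \<circ> inv_into U \<phi>))"

text \<open>
  The tangent space of \<open>M\<close> at \<open>p\<close> is identified with the model space \<open>'e\<close> through a chosen chart
  \<open>chart_at M p\<close> around \<open>p\<close>.  Another choice of chart changes this identification by the
  derivative of a transition map, which is a linear isomorphism.
\<close>

definition chart_at :: "('a, 'e) manifold \<Rightarrow> 'a \<Rightarrow> ('a, 'e) chart" where
  "chart_at M p = (SOME c. c \<in> charts M \<and> p \<in> fst c)"

definition mfderiv ::
  "('a, 'e::euclidean_space) manifold \<Rightarrow> ('b, 'f::euclidean_space) manifold \<Rightarrow> ('a \<Rightarrow> 'b) \<Rightarrow> 'a \<Rightarrow> 'e \<Rightarrow> 'f"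
  where
  "mfderiv M N f p =
     (let (U, \<phi>) = chart_at M p; (V, \<psi>) = chart_at N (f p)
      in frechet_derivative (\<psi> \<circ> f \<circ> inv_into U \<phi>) (at (\<phi> p)))"

definition immersion ::
  "('a, 'e::euclidean_space) manifold \<Rightarrow> ('b, 'f::euclidean_space) manifold \<Rightarrow> ('a \<Rightarrow> 'b) \<Rightarrow> bool" where
  "immersion M N f \<longleftrightarrow> smooth_map M N f \<and> (\<forall>p\<in>topspace (mtop M). inj (mfderiv M N f p))"

definition smooth_surface :: "('a, real^2) manifold \<Rightarrow> bool" where
  "smooth_surface S \<longleftrightarrow> smooth_manifold S \<and> topspace (mtop S) \<noteq> {}"


section \<open>The complex projective line\<close>

text \<open>\<open>Some z\<close> is the point with affine coordinate \<open>z\<close> and \<open>None\<close> is the point at infinity.\<close>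

type_synonym cp1 = "complex option"

definition P1_top :: "cp1 topology" where
  "P1_top = Alexandroff_compactification euclidean"

primrec affine_coord :: "cp1 \<Rightarrow> complex" where
  "affine_coord (Some z) = z"
| "affine_coord None = 0"   \<comment> \<open>outside the chart domain\<close>

primrec inverse_coord :: "cp1 \<Rightarrow> complex" where
  "inverse_coord (Some z) = 1 / z"
| "inverse_coord None = 0"

definition P1 :: "(cp1, complex) manifold" where
  "P1 = \<lparr>mtop = P1_top, charts = {(- {None}, affine_coord), (- {Some 0}, inverse_coord)}\<rparr>"

definition prod_manifold :: "('a, 'e) manifold \<Rightarrow> ('b, 'f) manifold \<Rightarrow> ('a \<times> 'b, 'e \<times> 'f) manifold" where
  "prod_manifold M N =
     \<lparr>mtop = prod_topology (mtop M) (mtop N),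
      charts = {(U \<times> V, map_prod \<phi> \<psi>) |U \<phi> V \<psi>. (U, \<phi>) \<in> charts M \<and> (V, \<psi>) \<in> charts N}\<rparr>"

text \<open>
  The structure transported to a set \<open>A\<close> along \<open>h\<close>; it is meant for \<open>h\<close> that maps \<open>A\<close>
  bijectively onto an open subset of \<open>N\<close>.
\<close>

definition pullback_manifold :: "'a set \<Rightarrow> ('a \<Rightarrow> 'b) \<Rightarrow> ('b, 'e) manifold \<Rightarrow> ('a, 'e) manifold" where
  "pullback_manifold A h N =
     \<lparr>mtop = pullback_topology A h (mtop N),
      charts = {(A \<inter> h -` V, \<psi> \<circ> h) |V \<psi>. (V, \<psi>) \<in> charts N}\<rparr>"


section \<open>Oriented geodesics of hyperbolic 3-space\<close>

type_synonym point3 = "complex \<times> real"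

definition H3 :: "point3 set" where
  "H3 = {(z, t). t > 0}"

definition hyp_dist :: "point3 \<Rightarrow> point3 \<Rightarrow> real" where
  "hyp_dist = (\<lambda>(z, s) (w, t). arcosh (1 + ((cmod (z - w))\<^sup>2 + (s - t)\<^sup>2) / (2 * s * t)))"

definition geodesic_line :: "(real \<Rightarrow> point3) \<Rightarrow> bool" where
  "geodesic_line g \<longleftrightarrow> range g \<subseteq> H3 \<and> (\<forall>s t. hyp_dist (g s) (g t) = \<bar>s - t\<bar>)"

text \<open>
  An oriented geodesic is a complete unit-speed geodesic up to translation of its parameter.
\<close>

type_synonym oriented_geodesic = "(real \<Rightarrow> point3) set"

definition oriented_geodesics :: "oriented_geodesic set" where
  "oriented_geodesics = {range (\<lambda>a s. g (s + a)) |g. geodesic_line g}"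

text \<open>
  The ideal boundary of the upper half-space is the sphere consisting of the points \<open>(z, 0)\<close> and of
  infinity; convergence to it is convergence in the one-point compactification of the ambient
  Euclidean space.
\<close>

definition tends_to_ideal :: "(real \<Rightarrow> point3) \<Rightarrow> cp1 \<Rightarrow> real filter \<Rightarrow> bool" where
  "tends_to_ideal g b F \<longleftrightarrow>
     limitin (Alexandroff_compactification euclidean) (\<lambda>s. Some (g s)) (map_option (\<lambda>z. (z, 0)) b) F"

definition begin_point :: "oriented_geodesic \<Rightarrow> cp1" where
  "begin_point \<gamma> = (THE b. \<forall>g\<in>\<gamma>. tends_to_ideal g b at_bot)"

definition end_point :: "oriented_geodesic \<Rightarrow> cp1" where
  "end_point \<gamma> = (THE b. \<forall>g\<in>\<gamma>. tends_to_ideal g b at_top)"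

definition P1_uminus :: "cp1 \<Rightarrow> cp1" where
  "P1_uminus = map_option uminus"

definition P1_inverse_cnj :: "cp1 \<Rightarrow> cp1" where
  "P1_inverse_cnj b =
     (case b of None \<Rightarrow> Some 0 | Some z \<Rightarrow> if z = 0 then None else Some (1 / cnj z))"

text \<open>
  The geodesic with coordinates \<open>(\<mu>\<^sub>1, \<mu>\<^sub>2)\<close> begins at \<open>-\<mu>\<^sub>1\<close> and ends at \<open>1 / cnj \<mu>\<^sub>2\<close>; both of these
  maps of the projective line are involutions.  As a geodesic is determined by its two end points,
  which are arbitrary distinct points of the ideal boundary, \<open>mu_coords\<close> is a bijection from the
  oriented geodesics onto the complement of the reflected diagonal \<open>\<mu>\<^sub>1 * cnj \<mu>\<^sub>2 = -1\<close> in the product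
  of two projective lines.
\<close>

definition mu_coords :: "oriented_geodesic \<Rightarrow> cp1 \<times> cp1" where
  "mu_coords \<gamma> = (P1_uminus (begin_point \<gamma>), P1_inverse_cnj (end_point \<gamma>))"

definition LH3 :: "(oriented_geodesic, complex \<times> complex) manifold" where
  "LH3 = pullback_manifold oriented_geodesics mu_coords (prod_manifold P1 P1)"

definition proj1 :: "oriented_geodesic \<Rightarrow> cp1" where
  "proj1 \<gamma> = fst (mu_coords \<gamma>)"


section \<open>Holomorphic curves and rank\<close>

text \<open>
  The complex structure in any of the charts of \<open>LH3\<close>; it does not depend on the chart, as the
  transition maps are holomorphic.
\<close>

definition JJ :: "complex \<times> complex \<Rightarrow> complex \<times> complex" where
  "JJ = (\<lambda>(u, v). (\<i> * u, \<i> * v))"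

definition complex_point ::
  "('a, real^2) manifold \<Rightarrow> ('a \<Rightarrow> oriented_geodesic) \<Rightarrow> 'a \<Rightarrow> bool" where
  "complex_point S f p \<longleftrightarrow> JJ ` range (mfderiv S LH3 f p) \<subseteq> range (mfderiv S LH3 f p)"

definition holomorphic_curve ::
  "('a, real^2) manifold \<Rightarrow> ('a \<Rightarrow> oriented_geodesic) \<Rightarrow> bool" where
  "holomorphic_curve S f \<longleftrightarrow> (\<forall>p\<in>topspace (mtop S). complex_point S f p)"

definition rank_at :: "('a, real^2) manifold \<Rightarrow> ('a \<Rightarrow> oriented_geodesic) \<Rightarrow> 'a \<Rightarrow> nat" where
  "rank_at S f p = dim (range (mfderiv S P1 (proj1 \<circ> f) p))"

definition of_rank ::
  "('a, real^2) manifold \<Rightarrow> ('a \<Rightarrow> oriented_geodesic) \<Rightarrow> nat \<Rightarrow> bool" where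
  "of_rank S f k \<longleftrightarrow> (\<forall>p\<in>topspace (mtop S). rank_at S f p = k)"

end

theory Submission
  imports Defs
begin

text \<open>
  The tangent plane of a holomorphic curve at a point is a complex subspace of the tangent space of
  the space of geodesics, and the projection to the coordinate \<open>\<mu>\<^sub>1\<close> is holomorphic. The image of
  the tangent plane in the tangent line of \<open>\<complex>P\<^sup>1\<close> is therefore again a complex subspace. This line
  has complex dimension one, so the image is zero or everything, of real dimension 0 or 2
  (\<open>dim_complex_invariant_neq_1\<close>). The obstruction is pointwise: each point of the curve has rank
  different from 1, and a surface has at least one point.

  The tangent spaces are read off in charts that are chosen separately for the space of geodesics
  and for \<open>\<complex>P\<^sup>1\<close>, so the chosen chart of \<open>\<complex>P\<^sup>1\<close> need not be the first factor of the chosen chart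
  of the space of geodesics. Changing it multiplies the derivative by a nonzero complex number
  (\<open>P1_coord_change\<close>), as the transition map \<open>z \<mapsto> 1 / z\<close> is holomorphic; so the comparison
  preserves complex subspaces (\<open>mfderiv_proj1\<close>).
\<close>

text \<open>
  A nonzero \<open>a\<close> and its rotation \<open>\<i> * a\<close> span the plane over the reals, so an invariant real
  subspace that contains \<open>a\<close> is the whole plane.
\<close>

lemma dim_complex_invariant_neq_1:
  fixes T :: "complex set"
  assumes T: "subspace T" and i: "(\<lambda>z. \<i> * z) ` T \<subseteq> T"
  shows "dim T \<noteq> 1"
proof (cases "T \<subseteq> {0}")
  case True
  then have "dim T = 0" by (simp only: dim_eq_0)
  then show ?thesis by linarith
next
  case False
  then obtain a where a: "a \<in> T" "a \<noteq> 0" by auto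
  have "w \<in> T" for w
  proof -
    define q where "q = w / a"
    have "w = q * a" using a by (simp add: q_def)
    also have "\<dots> = (complex_of_real (Re q) + \<i> * complex_of_real (Im q)) * a"
      by (simp only: complex_eq[symmetric])
    also have "\<dots> = Re q *\<^sub>R a + Im q *\<^sub>R (\<i> * a)"
      by (simp add: scaleR_conv_of_real algebra_simps)
    finally have "w = Re q *\<^sub>R a + Im q *\<^sub>R (\<i> * a)" .
    moreover have "\<i> * a \<in> T" using i a by auto
    ultimately show ?thesis
      using T a by (simp add: subspace_add subspace_scale)
  qed
  then have "T = UNIV" by auto
  then show ?thesis by simp
qed

text \<open>
  Since \<open>1 / 0 = 0\<close>, each of the two coordinates of \<open>\<complex>P\<^sup>1\<close> is the reciprocal of the other on all of
  \<open>\<complex>P\<^sup>1\<close>, also outside the chart domains. The equation \<open>\<psi> = h \<circ> \<phi>\<close> can thus be stated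
  globally, and the chain rule applies to it without localizing near \<open>b\<close>.
\<close>

lemma P1_coord_change:
  assumes "(U, \<phi>) \<in> charts P1" "(V, \<psi>) \<in> charts P1" "b \<in> U" "b \<in> V"
  obtains h c where "\<psi> = h \<circ> \<phi>" "(h has_field_derivative c) (at (\<phi> b))" "c \<noteq> 0"
proof (cases "\<phi> = \<psi>")
  case True
  then show thesis
    using that[of id 1] DERIV_ident by (simp add: id_def fun_eq_iff)
next
  case False
  have "inverse_coord x = 1 / affine_coord x" "affine_coord x = 1 / inverse_coord x" for x
    by (cases x; simp)+
  then have "inverse_coord = (\<lambda>z. 1 / z) \<circ> affine_coord"
      "affine_coord = (\<lambda>z. 1 / z) \<circ> inverse_coord"
    unfolding fun_eq_iff comp_def by blast+
  moreover have "\<phi> = affine_coord \<and> \<psi> = inverse_coord \<or> \<phi> = inverse_coord \<and> \<psi> = affine_coord"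
    using assms(1,2) False by (auto simp: P1_def)
  ultimately have eq: "\<psi> = (\<lambda>z. 1 / z) \<circ> \<phi>"
    by metis
  have nz: "\<phi> b \<noteq> 0"
    using assms False by (cases b) (auto simp: P1_def)
  have "((\<lambda>z. 1 / z) has_field_derivative - 1 / (\<phi> b)\<^sup>2) (at (\<phi> b))"
    using nz by (auto intro!: derivative_eq_intros simp: power2_eq_square)
  then show thesis
    using that[OF eq] nz by simp
qed

lemma chart_at_in_charts:
  assumes "p \<in> (\<Union>(U, \<phi>)\<in>charts M. U)" "chart_at M p = (U, \<phi>)"
  shows "(U, \<phi>) \<in> charts M" "p \<in> U"
proof -
  have "\<exists>c. c \<in> charts M \<and> p \<in> fst c" using assms(1) by force
  then have "chart_at M p \<in> charts M \<and> p \<in> fst (chart_at M p)"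
    unfolding chart_at_def by (rule someI_ex)
  then show "(U, \<phi>) \<in> charts M" "p \<in> U" using assms(2) by auto
qed

lemma P1_charts_cover: "(\<Union>(U, \<phi>)\<in>charts P1. U) = UNIV"
  by (auto simp: P1_def)

lemma LH3_charts_iff:
  "(W, \<xi>) \<in> charts LH3 \<longleftrightarrow>
     (\<exists>U \<phi> V \<psi>. (U, \<phi>) \<in> charts P1 \<and> (V, \<psi>) \<in> charts P1 \<and>
        W = oriented_geodesics \<inter> mu_coords -` (U \<times> V) \<and> \<xi> = map_prod \<phi> \<psi> \<circ> mu_coords)"
  unfolding LH3_def pullback_manifold_def prod_manifold_def by simp blast

lemma LH3_charts_cover: "topspace (mtop LH3) \<subseteq> (\<Union>(W, \<xi>)\<in>charts LH3. W)"
proof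
  fix \<gamma> assume "\<gamma> \<in> topspace (mtop LH3)"
  then have \<gamma>: "\<gamma> \<in> oriented_geodesics"
    by (simp add: LH3_def pullback_manifold_def topspace_pullback_topology)
  have cover: "\<exists>U \<phi>. (U, \<phi>) \<in> charts P1 \<and> b \<in> U" for b
  proof -
    have "b \<in> (\<Union>(U, \<phi>)\<in>charts P1. U)" by (simp only: P1_charts_cover UNIV_I)
    then show ?thesis by auto
  qed
  obtain U \<phi> V \<psi> where "(U, \<phi>) \<in> charts P1" "fst (mu_coords \<gamma>) \<in> U"
      and "(V, \<psi>) \<in> charts P1" "snd (mu_coords \<gamma>) \<in> V"
    using cover[of "fst (mu_coords \<gamma>)"] cover[of "snd (mu_coords \<gamma>)"] by auto
  then have "(oriented_geodesics \<inter> mu_coords -` (U \<times> V), map_prod \<phi> \<psi> \<circ> mu_coords) \<in> charts LH3"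
      and "\<gamma> \<in> oriented_geodesics \<inter> mu_coords -` (U \<times> V)"
    unfolding LH3_charts_iff using \<gamma> by (blast, simp add: mem_Times_iff)
  then show "\<gamma> \<in> (\<Union>(W, \<xi>)\<in>charts LH3. W)" by blast
qed

lemma smooth_map_differentiable:
  assumes "smooth_map M N f" "(U, \<phi>) \<in> charts M" "(V, \<psi>) \<in> charts N" "p \<in> U" "f p \<in> V"
  shows "(\<psi> \<circ> f \<circ> inv_into U \<phi>) differentiable (at (\<phi> p))"
proof -
  have "smooth_on (\<phi> ` (U \<inter> f -` V)) (\<psi> \<circ> f \<circ> inv_into U \<phi>)"
    using assms(1-3) by (auto simp: smooth_map_def)
  then have "Ck_on (Suc 0) (\<phi> ` (U \<inter> f -` V)) (\<psi> \<circ> f \<circ> inv_into U \<phi>)"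
    unfolding smooth_on_def by blast
  then show ?thesis using assms(4,5) by auto
qed

lemma smooth_manifold_chart_inj:
  assumes "smooth_manifold M" "(U, \<phi>) \<in> charts M"
  shows "inj_on \<phi> U"
proof -
  have "openin (mtop M) U"
      "homeomorphic_map (subtopology (mtop M) U) (top_of_set (\<phi> ` U)) \<phi>"
    using assms by (auto simp: smooth_manifold_def)
  then show ?thesis
    by (metis homeomorphic_imp_injective_map openin_subset topspace_subtopology_subset)
qed

text \<open>
  The derivative of \<open>\<mu>\<^sub>1\<close> along \<open>f\<close> is the first component of the derivative of \<open>f\<close>, up to the
  nonzero complex factor by which the two choices of coordinate on \<open>\<complex>P\<^sup>1\<close> differ.
\<close>

lemma mfderiv_proj1:
  fixes S :: "('a, 'e::euclidean_space) manifold"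
  assumes S: "smooth_manifold S" and f: "smooth_map S LH3 f" and p: "p \<in> topspace (mtop S)"
  obtains c where "c \<noteq> 0" "mfderiv S P1 (proj1 \<circ> f) p = (\<lambda>v. c * fst (mfderiv S LH3 f p v))"
    "linear (mfderiv S LH3 f p)"
proof -
  obtain U \<phi> where cS: "chart_at S p = (U, \<phi>)" by fastforce
  obtain W \<xi> where cL: "chart_at LH3 (f p) = (W, \<xi>)" by fastforce
  obtain V \<psi> where cP: "chart_at P1 ((proj1 \<circ> f) p) = (V, \<psi>)" by fastforce
  have "p \<in> (\<Union>(U, \<phi>)\<in>charts S. U)"
    using S p by (simp add: smooth_manifold_def)
  from chart_at_in_charts[OF this cS] have U: "(U, \<phi>) \<in> charts S" "p \<in> U" .
  have "f p \<in> topspace (mtop LH3)"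
    using f p by (auto simp: smooth_map_def dest: continuous_map_funspace)
  from chart_at_in_charts[OF subsetD[OF LH3_charts_cover this] cL]
  have W: "(W, \<xi>) \<in> charts LH3" "f p \<in> W" .
  have "(proj1 \<circ> f) p \<in> (\<Union>(U, \<phi>)\<in>charts P1. U)" by (simp add: P1_charts_cover)
  from chart_at_in_charts[OF this cP] have V: "(V, \<psi>) \<in> charts P1" "proj1 (f p) \<in> V" by auto
  from W obtain U1 \<phi>1 \<phi>2 where U1: "(U1, \<phi>1) \<in> charts P1" "proj1 (f p) \<in> U1"
      and \<xi>: "\<xi> = map_prod \<phi>1 \<phi>2 \<circ> mu_coords"
    unfolding LH3_charts_iff proj1_def by (auto simp: mem_Times_iff)
  obtain h c where h: "\<psi> = h \<circ> \<phi>1" "(h has_field_derivative c) (at (\<phi>1 (proj1 (f p))))" "c \<noteq> 0"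
    using P1_coord_change[OF U1(1) V(1) U1(2) V(2)] .
  define G where "G = \<xi> \<circ> f \<circ> inv_into U \<phi>"
  define D where "D = frechet_derivative G (at (\<phi> p))"
  have G: "(G has_derivative D) (at (\<phi> p))"
    using smooth_map_differentiable[OF f U(1) W(1) U(2) W(2)]
    by (simp add: G_def D_def frechet_derivative_works)
  have "fst (G (\<phi> p)) = \<phi>1 (proj1 (f p))"
    using U smooth_manifold_chart_inj[OF S U(1)] by (simp add: G_def \<xi> proj1_def)
  then have "(h has_derivative (*) c) (at (fst (G (\<phi> p))))"
    using h(2) by (simp add: has_field_derivative_def)
  from has_derivative_compose[OF has_derivative_fst[OF G] this]
  have "((\<lambda>x. h (fst (G x))) has_derivative (\<lambda>v. c * fst (D v))) (at (\<phi> p))" .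
  moreover have "(\<lambda>x. h (fst (G x))) = \<psi> \<circ> (proj1 \<circ> f) \<circ> inv_into U \<phi>"
    by (simp add: fun_eq_iff G_def h(1) \<xi> proj1_def)
  ultimately have "frechet_derivative (\<psi> \<circ> (proj1 \<circ> f) \<circ> inv_into U \<phi>) (at (\<phi> p))
      = (\<lambda>v. c * fst (D v))"
    by (metis frechet_derivative_at)
  moreover have "mfderiv S LH3 f p = D"
    by (simp add: mfderiv_def cS cL D_def G_def)
  moreover have "linear D"
    using G has_derivative_linear by blast
  ultimately show thesis
  proof (intro that)
    show "c \<noteq> 0" by (rule h(3))
  qed (use cP in \<open>simp_all add: mfderiv_def cS\<close>)
qed

lemma rank_at_complex_point_neq_1:
  assumes S: "smooth_manifold S" and f: "smooth_map S LH3 f" and p: "p \<in> topspace (mtop S)"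
    and J: "complex_point S f p"
  shows "rank_at S f p \<noteq> 1"
proof -
  define D where "D = mfderiv S LH3 f p"
  obtain c where c: "mfderiv S P1 (proj1 \<circ> f) p = (\<lambda>v. c * fst (D v))" and D: "linear D"
    using mfderiv_proj1[OF S f p] unfolding D_def by metis
  have "linear (\<lambda>v. c * fst (D v))"
    using linear_compose[OF D linear_compose[OF linear_fst linear_times[of c]]] by (simp add: o_def)
  then have "subspace (range (\<lambda>v. c * fst (D v)))"
    by (rule linear_subspace_image) (rule subspace_UNIV)
  moreover have "(\<lambda>z. \<i> * z) ` range (\<lambda>v. c * fst (D v)) \<subseteq> range (\<lambda>v. c * fst (D v))"
  proof clarsimp
    fix v
    have "JJ (D v) \<in> range D"
      using J by (auto simp: complex_point_def D_def)
    then obtain w where "D w = JJ (D v)" by auto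
    then have "\<i> * (c * fst (D v)) = c * fst (D w)"
      by (simp add: JJ_def case_prod_beta)
    then show "\<i> * (c * fst (D v)) \<in> range (\<lambda>v. c * fst (D v))" by blast
  qed
  ultimately show ?thesis
    unfolding rank_at_def c by (rule dim_complex_invariant_neq_1)
qed

theorem proposition4:
  fixes S :: "('a, real^2) manifold" and f :: "'a \<Rightarrow> oriented_geodesic"
  assumes "smooth_surface S"
    and "immersion S LH3 f"
    and "holomorphic_curve S f"
  shows "\<not> of_rank S f 1"
proof -
  obtain p where "p \<in> topspace (mtop S)"
    using assms(1) unfolding smooth_surface_def by blast
  then have "rank_at S f p \<noteq> 1"
    using assms
    by (intro rank_at_complex_point_neq_1)
      (auto simp: smooth_surface_def immersion_def holomorphic_curve_def)
  then show ?thesis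
    using \<open>p \<in> topspace (mtop S)\<close> by (auto simp: of_rank_def)
qed

end
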